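(* Let $F\in\mathcal{H}^d$, $A=\mathcal{A}(F)$ and $\mathbf{b}\in\Delta^d_{++}$. If $A^T\mathbf{b}=\mathbf{b}$, then $$\inf_{\mathbf{x}\in\mathcal{S}_{++}}\check{\mathrm{cw}}_{\mathbf{b}}(F,\mathbf{x})=r_{\mathbf{b}}(F)=\max_{\mathbf{x}\in\mathcal{S}_+}\widehat{\mathrm{cw}}_{\mathbf{b}}(F,\mathbf{x}).$$
   Context: $[n]=\{1,\ldots,n\}$. Fix positive integers $d,n_1,\ldots,n_d$. Let $\mathcal{K}_+=\mathbb{R}^{n_1}_+\times\cdots\times\mathbb{R}^{n_d}_+$ (nonnegative entries), $\mathcal{K}_{+,0}=(\mathbb{R}^{n_1}_+\setminus\{0\})\times\cdots\times(\mathbb{R}^{n_d}_+\setminus\{0\})$, $\mathcal{K}_{++}=\mathbb{R}^{n_1}_{++}\times\cdots\times\mathbb{R}^{n_d}_{++}$ (positive entries), $\Delta^d_{++}=\{\mathbf{z}\in\mathbb{R}^d_{++}:\sum_i z_i=1\}$. Write $\mathbf{x}=(\mathbf{x}_1,\ldots,\mathbf{x}_d)$, $\mathbf{x}_i=(x_{i,1},\ldots,x_{i,n_i})$, $F=(F_1,\ldots,F_d)$, $F_i=(F_{i,1},\ldots,F_{i,n_i})$; $F^m$ is the $m$-th iterate. $\mathbf{x}\le\mathbf{y}$ means $\mathbf{y}-\mathbf{x}\in\mathcal{K}_+$. For $\boldsymbol{\alpha}\in\mathbb{R}^d$, $\boldsymbol{\alpha}\otimes\mathbf{x}=(\alpha_1\mathbf{x}_1,\ldots,\alpha_d\mathbf{x}_d)$.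 For $\boldsymbol{\alpha}\in\mathbb{R}^d_{++}$ and $B\in\mathbb{R}^{d\times d}$, $\boldsymbol{\alpha}^B=(\prod_{k}\alpha_k^{B_{1,k}},\ldots,\prod_k\alpha_k^{B_{d,k}})$. $\mathbf{1}$ is the vector of all ones. $F\colon\mathcal{K}_+\to\mathcal{K}_+$ is order-preserving if $\mathbf{x}\le\mathbf{y}$ implies $F(\mathbf{x})\le F(\mathbf{y})$; it is multi-homogeneous with homogeneity matrix $\mathcal{A}(F)=A\in\mathbb{R}^{d\times d}$ if $F(\boldsymbol{\alpha}\otimes\mathbf{x})=\boldsymbol{\alpha}^A\otimes F(\mathbf{x})$ for all $\mathbf{x}\in\mathcal{K}_+$, $\boldsymbol{\alpha}\in\mathbb{R}^d_{++}$. $\mathcal{H}^d$ is the set of $F\colon\mathcal{K}_+\to\mathcal{K}_+$ that are continuous, order-preserving and multi-homogeneous, with $F(\mathbf{1})\in\mathcal{K}_{++}$ and such that $\mathcal{A}(F)$ has at least one nonzero entry per row. For each $i$, $\|\cdot\|_{\gamma_i}$ is a norm on $\mathbb{R}^{n_i}$, assumed monotonic ($0\le\mathbf{x}_i\le\mathbf{y}_i$ implies $\|\mathbf{x}_i\|_{\gamma_i}\le\|\mathbf{y}_i\|_{\gamma_i}$); $\mathcal{S}_+=\{\mathbf{x}\in\mathcal{K}_+:\|\mathbf{x}_i\|_{\gamma_i}=1\ \forall i\in[d]\}$ and $\mathcal{S}_{++}=\mathcal{S}_+\cap\mathcal{K}_{++}$. $$r_{\mathbf{b}}(F)=\sup_{\mathbf{x}\in\mathcal{K}_{+,0}}\limsup_{m\to\infty}\Big(\prod_{i=1}^d\|F^m_i(\mathbf{x})\|_{\gamma_i}^{b_i}\Big)^{1/m}.$$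 For $\mathbf{u}\in\mathcal{K}_{++}$ and $\mathbf{x}\in\mathcal{K}_{+,0}$, $$\check{\mathrm{cw}}_{\mathbf{b}}(F,\mathbf{u})=\prod_{i=1}^d\Big(\max_{j_i\in[n_i]}\frac{F_{i,j_i}(\mathbf{u})}{u_{i,j_i}}\Big)^{b_i},\qquad \widehat{\mathrm{cw}}_{\mathbf{b}}(F,\mathbf{x})=\prod_{i=1}^d\Big(\min_{j_i\in[n_i],\,x_{i,j_i}>0}\frac{F_{i,j_i}(\mathbf{x})}{x_{i,j_i}}\Big)^{b_i}.$$ *)

theory Defs
  imports "HOL-Analysis.Analysis"
begin

text \<open>
  The index set \<open>[d]\<close> is the universe of a finite type \<open>'d\<close>, and \<open>[n\<^sub>i]\<close> is a nonempty set
  \<open>J i :: 'n set\<close> over a finite type \<open>'n\<close>. A vector of the product of the \<open>d\<close> blocks is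
  an \<open>x :: real ^ 'n ^ 'd\<close> with \<open>x $ i $ j = 0\<close> for \<open>j \<notin> J i\<close>, so the \<open>i\<close>-th factor space is the
  coordinate subspace \<open>block J i\<close>. Since \<open>'d\<close>, \<open>'n\<close> and \<open>J\<close> are arbitrary, all positive
  \<open>d\<close>, \<open>n\<^sub>1\<close>, ..., \<open>n\<^sub>d\<close> occur, with \<open>n\<^sub>i = card (J i)\<close>. Maps are total functions on the ambient
  type; only their restriction to the nonnegative cone is ever constrained or used.
\<close>

definition block :: "('d \<Rightarrow> 'n set) \<Rightarrow> 'd \<Rightarrow> (real ^ 'n::finite) set" where
  "block J i = {v. \<forall>j. j \<notin> J i \<longrightarrow> v $ j = 0}"

definition K_plus :: "('d::finite \<Rightarrow> 'n::finite set) \<Rightarrow> (real ^ 'n ^ 'd) set" where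
  "K_plus J = {x. \<forall>i. x $ i \<in> block J i \<and> (\<forall>j\<in>J i. 0 \<le> x $ i $ j)}"

definition K_plus_0 :: "('d::finite \<Rightarrow> 'n::finite set) \<Rightarrow> (real ^ 'n ^ 'd) set" where
  "K_plus_0 J = {x \<in> K_plus J. \<forall>i. x $ i \<noteq> 0}"

definition K_pp :: "('d::finite \<Rightarrow> 'n::finite set) \<Rightarrow> (real ^ 'n ^ 'd) set" where
  "K_pp J = {x. \<forall>i. x $ i \<in> block J i \<and> (\<forall>j\<in>J i. 0 < x $ i $ j)}"

definition simplex_pp :: "(real ^ 'd::finite) set" where
  "simplex_pp = {z. (\<forall>i. 0 < z $ i) \<and> (\<Sum>i\<in>UNIV. z $ i) = 1}"

definition ones :: "('d::finite \<Rightarrow> 'n::finite set) \<Rightarrow> real ^ 'n ^ 'd" where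
  "ones J = (\<chi> i j. if j \<in> J i then 1 else 0)"

definition block_scale :: "real ^ 'd \<Rightarrow> real ^ 'n ^ 'd \<Rightarrow> real ^ 'n ^ 'd::finite" where
  "block_scale \<alpha> x = (\<chi> i. (\<alpha> $ i) *\<^sub>R (x $ i))"

definition vec_powr :: "real ^ 'd \<Rightarrow> real ^ 'd ^ 'd \<Rightarrow> real ^ 'd::finite" where
  "vec_powr \<alpha> B = (\<chi> i. \<Prod>k\<in>UNIV. (\<alpha> $ k) powr (B $ i $ k))"

text \<open>
  The library order on \<open>vec\<close> is componentwise, so on \<open>K_plus J\<close> the relation \<open>x \<le> y\<close>
  is \<open>y - x \<in> K_plus J\<close>.
\<close>

definition order_preserving ::
  "('d::finite \<Rightarrow> 'n::finite set) \<Rightarrow> (real ^ 'n ^ 'd \<Rightarrow> real ^ 'n ^ 'd) \<Rightarrow> bool" where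
  "order_preserving J F \<longleftrightarrow> (\<forall>x\<in>K_plus J. \<forall>y\<in>K_plus J. x \<le> y \<longrightarrow> F x \<le> F y)"

lemma le_iff_diff_K_plus:
  assumes "x \<in> K_plus J" "y \<in> K_plus J"
  shows "x \<le> y \<longleftrightarrow> y - x \<in> K_plus J"
proof
  assume "x \<le> y"
  then show "y - x \<in> K_plus J"
    using assms by (auto simp: less_eq_vec_def K_plus_def block_def)
next
  assume *: "y - x \<in> K_plus J"
  have "x $ i $ j \<le> y $ i $ j" for i j
    using * assms by (cases "j \<in> J i") (auto simp: K_plus_def block_def)
  then show "x \<le> y"
    by (auto simp: less_eq_vec_def)
qed

definition multi_homogeneous ::
  "('d::finite \<Rightarrow> 'n::finite set) \<Rightarrow> (real ^ 'n ^ 'd \<Rightarrow> real ^ 'n ^ 'd) \<Rightarrow> real ^ 'd ^ 'd \<Rightarrow> bool"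
where
  "multi_homogeneous J F A \<longleftrightarrow>
     (\<forall>x\<in>K_plus J. \<forall>\<alpha>. (\<forall>i. 0 < \<alpha> $ i) \<longrightarrow>
        F (block_scale \<alpha> x) = block_scale (vec_powr \<alpha> A) (F x))"

text \<open>
  The homogeneity matrix is unique as soon as \<open>F (ones J)\<close> is positive, so for \<open>F\<close> in the
  class below \<open>multi_homogeneous J F A\<close> says that \<open>A\<close> is the homogeneity matrix of \<open>F\<close>.
\<close>

lemma homogeneity_matrix_unique:
  assumes J: "\<And>i. J i \<noteq> {}" and pos: "F (ones J) \<in> K_pp J"
    and A: "multi_homogeneous J F A" and B: "multi_homogeneous J F B"
  shows "A = B"
proof -
  have "A $ i $ l = B $ i $ l" for i l
  proof -
    define \<alpha> :: "real ^ 'a" where "\<alpha> = (\<chi> k. if k = l then 2 else 1)"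
    have one: "ones J \<in> K_plus J"
      by (auto simp: K_plus_def block_def ones_def)
    have ap: "\<forall>k. 0 < \<alpha> $ k"
      by (simp add: \<alpha>_def)
    have eq: "block_scale (vec_powr \<alpha> A) (F (ones J)) = block_scale (vec_powr \<alpha> B) (F (ones J))"
      using A B one ap by (metis multi_homogeneous_def)
    have pw: "vec_powr \<alpha> C $ i = 2 powr (C $ i $ l)" for C
    proof -
      have "vec_powr \<alpha> C $ i = (\<Prod>k\<in>UNIV. if k = l then 2 powr (C $ i $ l) else 1)"
        unfolding vec_powr_def \<alpha>_def vec_lambda_beta by (rule prod.cong) simp_all
      then show ?thesis by simp
    qed
    obtain j where j: "j \<in> J i" using J by blast
    have "F (ones J) $ i $ j > 0"
      using pos j by (auto simp: K_pp_def)
    moreover have "2 powr (A $ i $ l) * F (ones J) $ i $ j = 2 powr (B $ i $ l) * F (ones J) $ i $ j"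
      using arg_cong[OF eq, of "\<lambda>z. z $ i $ j"] by (simp add: block_scale_def pw)
    ultimately show ?thesis using powr_inj[of 2 "A $ i $ l" "B $ i $ l"] by simp
  qed
  then show ?thesis by (simp add: vec_eq_iff)
qed

definition class_H ::
  "('d::finite \<Rightarrow> 'n::finite set) \<Rightarrow> (real ^ 'n ^ 'd \<Rightarrow> real ^ 'n ^ 'd) set" where
  "class_H J = {F. F \<in> K_plus J \<rightarrow> K_plus J \<and> continuous_on (K_plus J) F \<and>
     order_preserving J F \<and> F (ones J) \<in> K_pp J \<and>
     (\<exists>A. multi_homogeneous J F A \<and> (\<forall>i. \<exists>k. A $ i $ k \<noteq> 0))}"

definition norm_on :: "(real ^ 'n::finite) set \<Rightarrow> (real ^ 'n \<Rightarrow> real) \<Rightarrow> bool" where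
  "norm_on V N \<longleftrightarrow>
     (\<forall>v\<in>V. 0 \<le> N v \<and> (N v = 0 \<longleftrightarrow> v = 0)) \<and>
     (\<forall>v\<in>V. \<forall>c. N (c *\<^sub>R v) = \<bar>c\<bar> * N v) \<and>
     (\<forall>v\<in>V. \<forall>w\<in>V. N (v + w) \<le> N v + N w)"

definition monotonic_norm_on :: "(real ^ 'n::finite) set \<Rightarrow> (real ^ 'n \<Rightarrow> real) \<Rightarrow> bool" where
  "monotonic_norm_on V N \<longleftrightarrow>
     norm_on V N \<and> (\<forall>v\<in>V. \<forall>w\<in>V. 0 \<le> v \<and> v \<le> w \<longrightarrow> N v \<le> N w)"

definition S_plus ::
  "('d::finite \<Rightarrow> 'n::finite set) \<Rightarrow> ('d \<Rightarrow> real ^ 'n \<Rightarrow> real) \<Rightarrow> (real ^ 'n ^ 'd) set" where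
  "S_plus J \<nu> = {x \<in> K_plus J. \<forall>i. \<nu> i (x $ i) = 1}"

definition S_pp ::
  "('d::finite \<Rightarrow> 'n::finite set) \<Rightarrow> ('d \<Rightarrow> real ^ 'n \<Rightarrow> real) \<Rightarrow> (real ^ 'n ^ 'd) set" where
  "S_pp J \<nu> = S_plus J \<nu> \<inter> K_pp J"

text \<open>
  The supremum and limes superior are taken in the extended reals, so that no finiteness
  is presupposed. The term for \<open>m = 0\<close> (where \<open>1 / 0 = 0\<close>) does not affect the limes superior.
\<close>

definition spec_rad ::
  "('d::finite \<Rightarrow> 'n::finite set) \<Rightarrow> ('d \<Rightarrow> real ^ 'n \<Rightarrow> real) \<Rightarrow> real ^ 'd \<Rightarrow>
     (real ^ 'n ^ 'd \<Rightarrow> real ^ 'n ^ 'd) \<Rightarrow> ereal" where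
  "spec_rad J \<nu> b F =
     (SUP x\<in>K_plus_0 J. limsup (\<lambda>m. ereal
        ((\<Prod>i\<in>UNIV. (\<nu> i ((F ^^ m) x $ i)) powr (b $ i)) powr (1 / real m))))"

definition cw_upper ::
  "('d::finite \<Rightarrow> 'n::finite set) \<Rightarrow> real ^ 'd \<Rightarrow> (real ^ 'n ^ 'd \<Rightarrow> real ^ 'n ^ 'd) \<Rightarrow>
     real ^ 'n ^ 'd \<Rightarrow> real" where
  "cw_upper J b F u =
     (\<Prod>i\<in>UNIV. (Max ((\<lambda>j. F u $ i $ j / u $ i $ j) ` J i)) powr (b $ i))"

definition cw_lower ::
  "('d::finite \<Rightarrow> 'n::finite set) \<Rightarrow> real ^ 'd \<Rightarrow> (real ^ 'n ^ 'd \<Rightarrow> real ^ 'n ^ 'd) \<Rightarrow>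
     real ^ 'n ^ 'd \<Rightarrow> real" where
  "cw_lower J b F x =
     (\<Prod>i\<in>UNIV. (Min ((\<lambda>j. F x $ i $ j / x $ i $ j) ` {j \<in> J i. 0 < x $ i $ j})) powr (b $ i))"

end

theory Submission
  imports Defs
begin

text \<open>
  Write \<open>\<Pi>(\<alpha>) = \<Prod>\<^sub>i \<alpha>\<^sub>i\<^bsup>b\<^sub>i\<^esup>\<close>. The condition \<open>A\<^sup>T b = b\<close> says exactly that \<open>\<Pi>(\<alpha>\<^sup>A) = \<Pi>(\<alpha>)\<close> for
  positive \<open>\<alpha>\<close>, and this invariance makes the one-dimensional Collatz--Wielandt argument work
  for \<open>\<Pi>\<close> of the growth factors, although the individual factors may change from step to step.

  \<^item> If \<open>F u \<le> \<theta> \<otimes> u\<close> with \<open>\<theta> > 0\<close>, then order preservation and homogeneity give \<open>F\<^sup>m u \<le> \<beta> \<otimes> u\<close> for some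
    \<open>\<beta>\<close> with \<open>\<Pi>(\<beta>) = \<Pi>(\<theta>)\<^sup>m\<close>; the same holds with the inequalities reversed. Taking norms and
    \<open>m\<close>-th roots, every upper Collatz--Wielandt number bounds the spectral radius from above and
    every lower one bounds it from below (\<open>spec_rad_le_cw_upper\<close>, \<open>cw_lower_le_spec_rad\<close>).

  \<^item> It remains to find a vector whose lower number is at least the infimum of the upper
    numbers. On the product of the standard simplices, Brouwer's theorem gives for each
    \<open>\<delta> > 0\<close> a vector \<open>x\<close> with \<open>F x + \<delta> 1 = \<theta> \<otimes> x\<close>. Such an \<open>x\<close> is positive and satisfies
    \<open>F x \<le> \<theta> \<otimes> x\<close>, so \<open>\<Pi>(\<theta>)\<close> is at least the infimum. By compactness these pairs
    accumulate, as \<open>\<delta>\<close> tends to zero, at a solution of \<open>F x = \<theta> \<otimes> x\<close> with the same lower bound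
    on \<open>\<Pi>(\<theta>)\<close>, and \<open>\<Pi>(\<theta>)\<close> is the lower number of this \<open>x\<close>.

  Passing between the simplices and the unit spheres of the given norms is a rescaling of the
  blocks, which again leaves \<open>\<Pi>\<close> unchanged.
\<close>

section \<open>Weighted geometric products\<close>

definition wprod :: "real ^ 'd \<Rightarrow> real ^ 'd::finite \<Rightarrow> real" where
  "wprod b \<alpha> = (\<Prod>i\<in>UNIV. (\<alpha> $ i) powr (b $ i))"

lemma wprod_nonneg: "0 \<le> wprod b \<alpha>"
  by (simp add: wprod_def prod_nonneg)

lemma wprod_pos: "(\<And>i. 0 < \<alpha> $ i) \<Longrightarrow> 0 < wprod b \<alpha>"
  by (simp add: wprod_def prod_pos less_imp_neq[symmetric])

lemma wprod_mult:
  assumes "\<And>i. 0 \<le> \<alpha> $ i" "\<And>i. 0 \<le> \<beta> $ i"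
  shows "wprod b (\<alpha> * \<beta>) = wprod b \<alpha> * wprod b \<beta>"
  using assms by (simp add: wprod_def powr_mult prod.distrib)

lemma wprod_mono:
  assumes "\<And>i. 0 \<le> b $ i" "\<And>i. 0 \<le> \<alpha> $ i" "\<And>i. \<alpha> $ i \<le> \<beta> $ i"
  shows "wprod b \<alpha> \<le> wprod b \<beta>"
  unfolding wprod_def using assms by (intro prod_mono) (auto intro: powr_mono2)

text \<open>
  In logarithmic coordinates \<open>\<alpha> \<mapsto> \<alpha>\<^sup>A\<close> is multiplication by \<open>A\<close> and \<open>wprod b\<close> is the pairing
  with \<open>b\<close>, so this is \<open>b \<bullet> A y = A\<^sup>T b \<bullet> y = b \<bullet> y\<close>.
\<close>

lemma wprod_vec_powr:
  assumes "transpose A *v b = b" "\<And>i. 0 < \<alpha> $ i"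
  shows "wprod b (vec_powr \<alpha> A) = wprod b \<alpha>"
proof -
  have "wprod b (vec_powr \<alpha> A) = (\<Prod>i\<in>UNIV. \<Prod>k\<in>UNIV. (\<alpha> $ k) powr (A $ i $ k * b $ i))"
    by (simp add: wprod_def vec_powr_def prod_powr_distrib powr_powr)
  also have "\<dots> = (\<Prod>k\<in>UNIV. \<Prod>i\<in>UNIV. (\<alpha> $ k) powr (A $ i $ k * b $ i))"
    by (rule prod.swap)
  also have "\<dots> = (\<Prod>k\<in>UNIV. (\<alpha> $ k) powr (\<Sum>i\<in>UNIV. A $ i $ k * b $ i))"
    using assms(2) by (intro prod.cong refl powr_sum[symmetric]) (auto simp: less_imp_neq[symmetric])
  also have "\<dots> = (\<Prod>k\<in>UNIV. (\<alpha> $ k) powr ((transpose A *v b) $ k))"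
    by (simp add: matrix_vector_mult_def transpose_def)
  finally show ?thesis
    using assms(1) by (simp add: wprod_def)
qed

lemma vec_powr_pos: "(\<And>i. 0 < \<alpha> $ i) \<Longrightarrow> 0 < vec_powr \<alpha> A $ i"
  by (auto simp: vec_powr_def intro!: prod_pos) (metis less_irrefl)

section \<open>The cone and its blocks\<close>

lemma K_plus_iff:
  "x \<in> K_plus J \<longleftrightarrow> (\<forall>i j. 0 \<le> x $ i $ j) \<and> (\<forall>i j. j \<notin> J i \<longrightarrow> x $ i $ j = 0)"
  unfolding K_plus_def block_def by auto (metis order_refl)

lemma K_pp_subset_K_plus: "K_pp J \<subseteq> K_plus J"
  by (auto simp: K_plus_def K_pp_def intro: less_imp_le)

lemma block_scale_nth [simp]: "block_scale \<alpha> x $ i $ j = \<alpha> $ i * x $ i $ j"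
  by (simp add: block_scale_def)

lemma block_scale_block_scale: "block_scale \<alpha> (block_scale \<beta> x) = block_scale (\<alpha> * \<beta>) x"
  by (simp add: vec_eq_iff mult.assoc)

lemma block_scale_mono:
  assumes "x \<le> y" "\<And>i. 0 \<le> \<alpha> $ i"
  shows "block_scale \<alpha> x \<le> block_scale \<alpha> y"
  using assms by (simp add: less_eq_vec_def mult_left_mono)

lemma block_scale_in_K_plus:
  "x \<in> K_plus J \<Longrightarrow> (\<And>i. 0 \<le> \<alpha> $ i) \<Longrightarrow> block_scale \<alpha> x \<in> K_plus J"
  by (simp add: K_plus_iff)

lemma block_scale_in_K_pp:
  "x \<in> K_pp J \<Longrightarrow> (\<And>i. 0 < \<alpha> $ i) \<Longrightarrow> block_scale \<alpha> x \<in> K_pp J"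
  by (simp add: K_pp_def block_def)

lemma K_pp_dominates:
  assumes "u \<in> K_pp J" "x \<in> K_plus J"
  obtains c where "0 < c" "x \<le> block_scale (vec c) u"
proof -
  define c where "c = 1 + (\<Sum>i\<in>UNIV. \<Sum>j\<in>UNIV. x $ i $ j / u $ i $ j)"
  have "u \<in> K_plus J" using assms(1) K_pp_subset_K_plus by blast
  then have u0: "0 \<le> u $ i $ j" for i j by (simp add: K_plus_iff)
  have q0: "0 \<le> x $ i $ j / u $ i $ j" for i j
    using u0 assms(2) by (simp add: K_plus_iff)
  have qc: "x $ i $ j / u $ i $ j \<le> c" for i j
  proof -
    have "x $ i $ j / u $ i $ j \<le> (\<Sum>j\<in>UNIV. x $ i $ j / u $ i $ j)"
      using q0 by (intro member_le_sum) auto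
    also have "\<dots> \<le> (\<Sum>i\<in>UNIV. \<Sum>j\<in>UNIV. x $ i $ j / u $ i $ j)"
      using q0 by (intro member_le_sum[where f = "\<lambda>i. \<Sum>j\<in>UNIV. x $ i $ j / u $ i $ j"])
        (auto intro!: sum_nonneg)
    finally show ?thesis by (simp add: c_def)
  qed
  have "x $ i $ j \<le> c * u $ i $ j" for i j
  proof (cases "j \<in> J i")
    case True
    then have "0 < u $ i $ j" using assms(1) by (auto simp: K_pp_def)
    then show ?thesis using qc[of i j] by (simp add: field_simps)
  next
    case False
    then show ?thesis using assms(1,2) by (simp add: K_plus_iff K_pp_def block_def)
  qed
  moreover have "0 < c"
    unfolding c_def using q0 by (intro add_pos_nonneg sum_nonneg) auto
  ultimately show thesis
    by (intro that[of c]) (simp_all add: less_eq_vec_def)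
qed

section \<open>Growth factors under iteration\<close>

locale multi_homogeneous_map =
  fixes J :: "'d::finite \<Rightarrow> 'n::finite set"
    and F :: "real ^ 'n ^ 'd \<Rightarrow> real ^ 'n ^ 'd"
    and A :: "real ^ 'd ^ 'd"
    and b :: "real ^ 'd"
  assumes J_nonempty: "J i \<noteq> {}"
    and maps: "x \<in> K_plus J \<Longrightarrow> F x \<in> K_plus J"
    and mono: "x \<in> K_plus J \<Longrightarrow> y \<in> K_plus J \<Longrightarrow> x \<le> y \<Longrightarrow> F x \<le> F y"
    and cont: "continuous_on (K_plus J) F"
    and F_ones: "F (ones J) \<in> K_pp J"
    and homog: "x \<in> K_plus J \<Longrightarrow> (\<And>i. 0 < \<alpha> $ i) \<Longrightarrow>
      F (block_scale \<alpha> x) = block_scale (vec_powr \<alpha> A) (F x)"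
    and b_pos: "0 < b $ i"
    and invariant: "transpose A *v b = b"
begin

lemma maps_iterate: "x \<in> K_plus J \<Longrightarrow> (F ^^ m) x \<in> K_plus J"
  by (induction m) (auto intro: maps)

lemma mono_iterate:
  assumes "x \<in> K_plus J" "y \<in> K_plus J" "x \<le> y"
  shows "(F ^^ m) x \<le> (F ^^ m) y"
  using assms by (induction m) (auto intro: mono maps_iterate)

lemma maps_K_pp:
  assumes "u \<in> K_pp J"
  shows "F u \<in> K_pp J"
proof -
  have one: "ones J \<in> K_plus J" by (simp add: K_plus_iff ones_def)
  obtain c where c: "0 < c" "ones J \<le> block_scale (vec c) u"
    using K_pp_dominates[OF assms one] .
  have u: "u \<in> K_plus J" using assms K_pp_subset_K_plus by blast
  have "F (ones J) \<le> F (block_scale (vec c) u)"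
    using c u one by (intro mono block_scale_in_K_plus) auto
  also have "\<dots> = block_scale (vec_powr (vec c) A) (F u)"
    using c u by (intro homog) auto
  finally have le: "F (ones J) $ i $ j \<le> vec_powr (vec c) A $ i * F u $ i $ j" for i j
    by (simp add: less_eq_vec_def)
  have "0 < F u $ i $ j" if "j \<in> J i" for i j
  proof -
    have "0 < F (ones J) $ i $ j" using F_ones that by (auto simp: K_pp_def)
    also note le
    finally show ?thesis
      using vec_powr_pos[of "vec c" A i] c(1) by (simp add: zero_less_mult_iff)
  qed
  then show ?thesis
    using maps[OF u] by (auto simp: K_pp_def K_plus_def)
qed

text \<open>
  One step turns the factor \<open>\<beta>\<close> into \<open>\<beta>\<^sup>A \<theta>\<close>, whose weighted product is that of \<open>\<beta>\<close> times
  that of \<open>\<theta>\<close>.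
\<close>

lemma iterate_upper:
  assumes "u \<in> K_plus J" "\<And>i. 0 < \<theta> $ i" "F u \<le> block_scale \<theta> u"
  shows "\<exists>\<beta>. (\<forall>i. 0 < \<beta> $ i) \<and> wprod b \<beta> = wprod b \<theta> ^ m \<and> (F ^^ m) u \<le> block_scale \<beta> u"
proof (induction m)
  case 0
  show ?case by (intro exI[of _ 1]) (simp add: wprod_def less_eq_vec_def)
next
  case (Suc m)
  then obtain \<beta> where \<beta>: "\<And>i. 0 < \<beta> $ i" "wprod b \<beta> = wprod b \<theta> ^ m"
    "(F ^^ m) u \<le> block_scale \<beta> u" by blast
  have p: "0 < vec_powr \<beta> A $ i" for i using \<beta>(1) by (rule vec_powr_pos)
  have "F ((F ^^ m) u) \<le> F (block_scale \<beta> u)"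
    using \<beta> assms(1) by (intro mono maps_iterate block_scale_in_K_plus) (auto intro: less_imp_le)
  also have "\<dots> = block_scale (vec_powr \<beta> A) (F u)"
    using \<beta> assms(1) by (intro homog)
  also have "\<dots> \<le> block_scale (vec_powr \<beta> A) (block_scale \<theta> u)"
    using assms(3) p by (intro block_scale_mono) (auto intro: less_imp_le)
  finally have "(F ^^ Suc m) u \<le> block_scale (vec_powr \<beta> A * \<theta>) u"
    by (simp add: block_scale_block_scale)
  moreover have "wprod b (vec_powr \<beta> A * \<theta>) = wprod b \<theta> ^ Suc m"
    using p assms(2) \<beta> by (subst wprod_mult) (auto simp: wprod_vec_powr[OF invariant] less_imp_le)
  ultimately show ?case
    using p assms(2) by (intro exI[of _ "vec_powr \<beta> A * \<theta>"]) auto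
qed

lemma iterate_lower:
  assumes "u \<in> K_plus J" "\<And>i. 0 < \<theta> $ i" "block_scale \<theta> u \<le> F u"
  shows "\<exists>\<beta>. (\<forall>i. 0 < \<beta> $ i) \<and> wprod b \<beta> = wprod b \<theta> ^ m \<and> block_scale \<beta> u \<le> (F ^^ m) u"
proof (induction m)
  case 0
  show ?case by (intro exI[of _ 1]) (simp add: wprod_def less_eq_vec_def)
next
  case (Suc m)
  then obtain \<beta> where \<beta>: "\<And>i. 0 < \<beta> $ i" "wprod b \<beta> = wprod b \<theta> ^ m"
    "block_scale \<beta> u \<le> (F ^^ m) u" by blast
  have p: "0 < vec_powr \<beta> A $ i" for i using \<beta>(1) by (rule vec_powr_pos)
  have "block_scale (vec_powr \<beta> A) (block_scale \<theta> u) \<le> block_scale (vec_powr \<beta> A) (F u)"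
    using assms(3) p by (intro block_scale_mono) (auto intro: less_imp_le)
  also have "\<dots> = F (block_scale \<beta> u)"
    using \<beta> assms(1) by (intro homog[symmetric])
  also have "\<dots> \<le> F ((F ^^ m) u)"
    using \<beta> assms(1) by (intro mono maps_iterate block_scale_in_K_plus) (auto intro: less_imp_le)
  finally have "block_scale (vec_powr \<beta> A * \<theta>) u \<le> (F ^^ Suc m) u"
    by (simp add: block_scale_block_scale)
  moreover have "wprod b (vec_powr \<beta> A * \<theta>) = wprod b \<theta> ^ Suc m"
    using p assms(2) \<beta> by (subst wprod_mult) (auto simp: wprod_vec_powr[OF invariant] less_imp_le)
  ultimately show ?case
    using p assms(2) by (intro exI[of _ "vec_powr \<beta> A * \<theta>"]) auto
qed

text \<open>
  Rescaling \<open>x\<close> by \<open>\<alpha>\<close> changes the factor of \<open>F\<close> on \<open>x\<close> from \<open>\<theta>\<close> to \<open>\<alpha>\<^sup>A \<theta> / \<alpha>\<close>,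
  which has the same weighted product.
\<close>

definition rescaled_factor :: "real ^ 'd \<Rightarrow> real ^ 'd \<Rightarrow> real ^ 'd" where
  "rescaled_factor \<alpha> \<theta> = vec_powr \<alpha> A * \<theta> * (\<chi> i. inverse (\<alpha> $ i))"

lemma rescaled_factor_nonneg:
  assumes "\<And>i. 0 < \<alpha> $ i" "\<And>i. 0 \<le> \<theta> $ i"
  shows "0 \<le> rescaled_factor \<alpha> \<theta> $ i"
  unfolding rescaled_factor_def using assms vec_powr_pos[of \<alpha> A i] by (simp add: less_imp_le)

lemma wprod_rescaled_factor:
  assumes "\<And>i. 0 < \<alpha> $ i" "\<And>i. 0 \<le> \<theta> $ i"
  shows "wprod b (rescaled_factor \<alpha> \<theta>) = wprod b \<theta>"
proof -
  have p: "0 < vec_powr \<alpha> A $ i" for i using assms(1) by (rule vec_powr_pos)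
  have "wprod b (rescaled_factor \<alpha> \<theta>) = wprod b \<theta> * (wprod b \<alpha> * wprod b (\<chi> i. inverse (\<alpha> $ i)))"
    unfolding rescaled_factor_def using p assms
    by (simp add: wprod_mult wprod_vec_powr[OF invariant] less_imp_le)
  also have "wprod b \<alpha> * wprod b (\<chi> i. inverse (\<alpha> $ i)) = wprod b (\<alpha> * (\<chi> i. inverse (\<alpha> $ i)))"
    using assms(1) by (simp add: wprod_mult less_imp_le)
  also have "\<dots> = 1"
    using assms(1) by (simp add: wprod_def less_imp_neq[symmetric])
  finally show ?thesis by simp
qed

lemma F_block_scale_upper:
  assumes "x \<in> K_plus J" "\<And>i. 0 < \<alpha> $ i" "F x \<le> block_scale \<theta> x"
  shows "F (block_scale \<alpha> x) \<le> block_scale (rescaled_factor \<alpha> \<theta>) (block_scale \<alpha> x)"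
proof -
  have p: "0 \<le> vec_powr \<alpha> A $ i" for i using vec_powr_pos[of \<alpha> A i] assms(2) by (simp add: less_imp_le)
  have "F (block_scale \<alpha> x) = block_scale (vec_powr \<alpha> A) (F x)"
    using assms by (intro homog)
  also have "\<dots> \<le> block_scale (vec_powr \<alpha> A) (block_scale \<theta> x)"
    using assms(3) p by (intro block_scale_mono)
  also have "\<dots> = block_scale (rescaled_factor \<alpha> \<theta>) (block_scale \<alpha> x)"
    using assms(2) by (simp add: vec_eq_iff rescaled_factor_def less_imp_neq[symmetric])
  finally show ?thesis .
qed

lemma F_block_scale_eigen:
  assumes "x \<in> K_plus J" "\<And>i. 0 < \<alpha> $ i" "F x = block_scale \<theta> x"
  shows "F (block_scale \<alpha> x) = block_scale (rescaled_factor \<alpha> \<theta>) (block_scale \<alpha> x)"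
proof -
  have "F (block_scale \<alpha> x) = block_scale (vec_powr \<alpha> A) (block_scale \<theta> x)"
    using homog[OF assms(1,2)] assms(3) by simp
  also have "\<dots> = block_scale (rescaled_factor \<alpha> \<theta>) (block_scale \<alpha> x)"
    using assms(2) by (simp add: vec_eq_iff rescaled_factor_def less_imp_neq[symmetric])
  finally show ?thesis .
qed

section \<open>Collatz--Wielandt numbers as optimal growth factors\<close>

lemma F_le_cw_upper:
  assumes "u \<in> K_pp J"
  obtains \<theta> where "\<And>i. 0 < \<theta> $ i" "F u \<le> block_scale \<theta> u" "wprod b \<theta> = cw_upper J b F u"
proof
  define \<theta> :: "real ^ 'd" where "\<theta> = (\<chi> i. Max ((\<lambda>j. F u $ i $ j / u $ i $ j) ` J i))"
  have quot: "F u $ i $ j / u $ i $ j \<le> \<theta> $ i" if "j \<in> J i" for i j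
    using that by (simp add: \<theta>_def)
  have pos: "0 < u $ i $ j" "0 < F u $ i $ j" if "j \<in> J i" for i j
    using that assms maps_K_pp[OF assms] by (auto simp: K_pp_def)
  show "0 < \<theta> $ i" for i
  proof -
    obtain j where j: "j \<in> J i" using J_nonempty by blast
    then have "0 < F u $ i $ j / u $ i $ j" using pos by simp
    also have "\<dots> \<le> \<theta> $ i" using quot j by blast
    finally show ?thesis .
  qed
  have "F u $ i $ j \<le> \<theta> $ i * u $ i $ j" for i j
  proof (cases "j \<in> J i")
    case True
    then show ?thesis using quot[OF True] pos[OF True] by (simp add: field_simps)
  next
    case False
    then show ?thesis using assms maps_K_pp[OF assms] by (simp add: K_pp_def block_def)
  qed
  then show "F u \<le> block_scale \<theta> u" by (simp add: less_eq_vec_def)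
  show "wprod b \<theta> = cw_upper J b F u"
    by (simp add: wprod_def \<theta>_def cw_upper_def)
qed

lemma cw_upper_le:
  assumes "u \<in> K_pp J" "F u \<le> block_scale \<theta> u"
  shows "cw_upper J b F u \<le> wprod b \<theta>"
proof -
  have pos: "0 < u $ i $ j" "0 < F u $ i $ j" if "j \<in> J i" for i j
    using that assms maps_K_pp[OF assms(1)] by (auto simp: K_pp_def)
  have quot: "F u $ i $ j / u $ i $ j \<le> \<theta> $ i" if "j \<in> J i" for i j
    using assms(2) pos[OF that] by (simp add: less_eq_vec_def field_simps)
  have "0 \<le> Max ((\<lambda>j. F u $ i $ j / u $ i $ j) ` J i)" for i
    using J_nonempty[of i] pos by (subst Max_ge_iff) (force intro: less_imp_le divide_pos_pos)+
  moreover have "Max ((\<lambda>j. F u $ i $ j / u $ i $ j) ` J i) \<le> \<theta> $ i" for i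
    using J_nonempty[of i] quot by (subst Max_le_iff) auto
  ultimately have "wprod b (\<chi> i. Max ((\<lambda>j. F u $ i $ j / u $ i $ j) ` J i)) \<le> wprod b \<theta>"
    using b_pos by (intro wprod_mono) (auto intro: less_imp_le)
  then show ?thesis by (simp add: wprod_def cw_upper_def)
qed

lemma support_nonempty:
  assumes "x \<in> K_plus_0 J"
  shows "{j \<in> J i. 0 < x $ i $ j} \<noteq> {}"
proof
  assume *: "{j \<in> J i. 0 < x $ i $ j} = {}"
  have x: "x \<in> K_plus J" "x $ i \<noteq> 0" using assms by (auto simp: K_plus_0_def)
  have "x $ i $ j = 0" for j
    using * x(1) unfolding K_plus_iff by (cases "j \<in> J i") (force simp: less_le)+
  then show False using x(2) by (simp add: vec_eq_iff)
qed

lemma cw_lower_le_F: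
  assumes "x \<in> K_plus_0 J"
  obtains \<theta> where "\<And>i. 0 \<le> \<theta> $ i" "block_scale \<theta> x \<le> F x" "wprod b \<theta> = cw_lower J b F x"
proof
  define \<theta> :: "real ^ 'd" where
    "\<theta> = (\<chi> i. Min ((\<lambda>j. F x $ i $ j / x $ i $ j) ` {j \<in> J i. 0 < x $ i $ j}))"
  have x: "x \<in> K_plus J" "F x \<in> K_plus J" using assms maps by (auto simp: K_plus_0_def)
  have quot: "\<theta> $ i \<le> F x $ i $ j / x $ i $ j" if "j \<in> J i" "0 < x $ i $ j" for i j
    using that by (simp add: \<theta>_def)
  show "0 \<le> \<theta> $ i" for i
    unfolding \<theta>_def vec_lambda_beta using support_nonempty[OF assms, of i] x
    by (subst Min_ge_iff) (auto simp: K_plus_iff)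
  have "\<theta> $ i * x $ i $ j \<le> F x $ i $ j" for i j
  proof (cases "0 < x $ i $ j")
    case True
    then have "j \<in> J i" using x unfolding K_plus_iff by force
    then show ?thesis using quot[of j i] True by (simp add: field_simps)
  next
    case False
    moreover have "0 \<le> x $ i $ j" using x by (simp add: K_plus_iff)
    ultimately have "x $ i $ j = 0" by simp
    then show ?thesis using x by (simp add: K_plus_iff)
  qed
  then show "block_scale \<theta> x \<le> F x" by (simp add: less_eq_vec_def)
  show "wprod b \<theta> = cw_lower J b F x"
    by (simp add: wprod_def \<theta>_def cw_lower_def)
qed

lemma cw_lower_eigen:
  assumes "x \<in> K_plus_0 J" "F x = block_scale \<theta> x"
  shows "cw_lower J b F x = wprod b \<theta>"
proof -
  have "(\<lambda>j. F x $ i $ j / x $ i $ j) ` {j \<in> J i. 0 < x $ i $ j} = {\<theta> $ i}" for i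
    using support_nonempty[OF assms(1), of i] assms(2) by (auto simp: image_iff)
  then show ?thesis by (simp add: cw_lower_def wprod_def)
qed

section \<open>Perturbed eigenvectors\<close>

definition simplices :: "(real ^ 'n ^ 'd) set" where
  "simplices = {x \<in> K_plus J. \<forall>i. (\<Sum>j\<in>UNIV. x $ i $ j) = 1}"

lemma convex_simplices: "convex simplices"
  unfolding convex_def simplices_def
  by (auto simp: K_plus_iff sum.distrib sum_distrib_left[symmetric])

lemma compact_simplices: "compact simplices"
proof -
  have "x $ i $ j \<le> 1" if "x \<in> simplices" for x i j
    using that member_le_sum[of j UNIV "\<lambda>j. x $ i $ j"]
    by (auto simp: simplices_def K_plus_iff)
  then have "simplices \<subseteq> {x. \<forall>i j. x $ i $ j \<in> {0..1}}"
    by (auto simp: simplices_def K_plus_iff)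
  moreover have "bounded {x :: real ^ 'n ^ 'd. \<forall>i j. x $ i $ j \<in> {0..1}}"
  proof (rule boundedI)
    fix x :: "real ^ 'n ^ 'd" assume x: "x \<in> {x. \<forall>i j. x $ i $ j \<in> {0..1}}"
    have "norm x \<le> (\<Sum>i\<in>UNIV. norm (x $ i))"
      unfolding norm_vec_def[of x] by (rule L2_set_le_sum) simp
    also have "\<dots> \<le> (\<Sum>i\<in>(UNIV :: 'd set). \<Sum>j\<in>(UNIV :: 'n set). 1)"
      using x by (intro sum_mono order_trans[OF norm_le_l1_cart]) (auto intro!: sum_mono)
    finally show "norm x \<le> (\<Sum>i\<in>(UNIV :: 'd set). \<Sum>j\<in>(UNIV :: 'n set). 1)" .
  qed
  moreover have "closed simplices"
  proof -
    have "simplices = (\<Inter>i j. {x. 0 \<le> x $ i $ j}) \<inter> (\<Inter>i. \<Inter>j\<in>- J i. {x. x $ i $ j = 0}) \<inter>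
        (\<Inter>i. {x. (\<Sum>j\<in>UNIV. x $ i $ j) = 1})"
      by (auto simp: simplices_def K_plus_iff)
    also have "closed \<dots>"
      by (intro closed_Int closed_INT ballI closed_Collect_le closed_Collect_eq continuous_intros)
    finally show ?thesis .
  qed
  ultimately show ?thesis
    using bounded_subset compact_eq_bounded_closed by blast
qed

lemma simplices_nonempty: "simplices \<noteq> {}"
proof -
  have "card (J i) \<noteq> 0" for i using J_nonempty[of i] by simp
  then have "(\<chi> i j. if j \<in> J i then 1 / real (card (J i)) else 0) \<in> simplices"
    by (auto simp: simplices_def K_plus_iff sum.If_cases)
  then show ?thesis by blast
qed

lemma simplices_subset_K_plus_0: "simplices \<subseteq> K_plus_0 J"
proof
  fix x assume x: "x \<in> simplices"
  have "x $ i \<noteq> 0" for i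
  proof
    assume "x $ i = 0"
    then have "(\<Sum>j\<in>UNIV. x $ i $ j) = 0" by simp
    then show False using x by (simp add: simplices_def)
  qed
  then show "x \<in> K_plus_0 J" using x by (simp add: simplices_def K_plus_0_def)
qed

text \<open>
  Adding \<open>\<delta>\<close> to every coordinate keeps the block sums away from zero, so that the perturbed map
  can be normalised to a continuous self-map of the simplices.
\<close>

lemma perturbed_eigenvector:
  assumes "0 < \<delta>"
  obtains x where "x \<in> simplices"
    "F x + \<delta> *\<^sub>R ones J = block_scale (\<chi> i. \<Sum>j\<in>UNIV. (F x + \<delta> *\<^sub>R ones J) $ i $ j) x"
proof -
  define P where "P x = F x + \<delta> *\<^sub>R ones J" for x
  define G where "G x = block_scale (\<chi> i. inverse (\<Sum>j\<in>UNIV. P x $ i $ j)) (P x)" for x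
  have P: "P x \<in> K_pp J" if "x \<in> simplices" for x
    using that maps[of x] assms
    by (auto simp: simplices_def K_plus_iff K_pp_def P_def ones_def block_def
        intro!: add_nonneg_pos)
  have S: "0 < (\<Sum>j\<in>UNIV. P x $ i $ j)" if "x \<in> simplices" for x i
  proof -
    obtain j where j: "j \<in> J i" using J_nonempty by blast
    have "P x \<in> K_plus J" using P[OF that] K_pp_subset_K_plus by blast
    then show ?thesis
      using j P[OF that] by (intro sum_pos2[of _ j]) (auto simp: K_pp_def K_plus_iff)
  qed
  have contF: "continuous_on simplices F"
    by (rule continuous_on_subset[OF cont]) (auto simp: simplices_def)
  have ne: "\<forall>x\<in>simplices. (\<Sum>j\<in>UNIV. P x $ i $ j) \<noteq> 0" for i
    using S by (metis less_irrefl)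
  have contP: "continuous_on simplices P"
    unfolding P_def by (intro continuous_intros contF)
  have "continuous_on simplices G"
    unfolding G_def block_scale_def vec_lambda_beta
    by (intro continuous_intros contP ne)
  moreover have "G x \<in> simplices" if "x \<in> simplices" for x
  proof -
    have "P x \<in> K_plus J" using P[OF that] K_pp_subset_K_plus by blast
    then have "G x \<in> K_plus J"
      unfolding G_def using S[OF that] by (intro block_scale_in_K_plus) (auto intro: less_imp_le)
    moreover have "(\<Sum>j\<in>UNIV. G x $ i $ j) = 1" for i
      using S[OF that, of i] by (simp add: G_def sum_distrib_left[symmetric])
    ultimately show ?thesis by (simp add: simplices_def)
  qed
  ultimately obtain x where x: "x \<in> simplices" "G x = x"
    using brouwer[OF compact_simplices convex_simplices simplices_nonempty, of G] by blast
  have "block_scale (\<chi> i. \<Sum>j\<in>UNIV. P x $ i $ j) (G x) = P x"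
    using S[OF x(1)] by (simp add: G_def vec_eq_iff less_imp_neq[symmetric])
  then show thesis using x that by (simp add: P_def)
qed

end

section \<open>Bounding the spectral radius\<close>

locale normed_multi_homogeneous_map = multi_homogeneous_map J F A b
  for J :: "'d::finite \<Rightarrow> 'n::finite set"
    and F :: "real ^ 'n ^ 'd \<Rightarrow> real ^ 'n ^ 'd"
    and A :: "real ^ 'd ^ 'd"
    and b :: "real ^ 'd" +
  fixes \<nu> :: "'d \<Rightarrow> real ^ 'n \<Rightarrow> real"
  assumes norm: "monotonic_norm_on (block J i) (\<nu> i)"
begin

definition norms :: "real ^ 'n ^ 'd \<Rightarrow> real ^ 'd" where
  "norms x = (\<chi> i. \<nu> i (x $ i))"

lemma norms_nonneg: "x \<in> K_plus J \<Longrightarrow> 0 \<le> norms x $ i"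
  using norm[of i] by (auto simp: norms_def K_plus_def monotonic_norm_on_def norm_on_def)

lemma norms_pos: "x \<in> K_plus_0 J \<Longrightarrow> 0 < norms x $ i"
  using norm[of i]
  by (auto simp: norms_def K_plus_0_def K_plus_def monotonic_norm_on_def norm_on_def less_le)

lemma norms_mono:
  assumes "x \<in> K_plus J" "y \<in> K_plus J" "x \<le> y"
  shows "norms x $ i \<le> norms y $ i"
proof -
  have "0 \<le> x $ i" "x $ i \<le> y $ i" "x $ i \<in> block J i" "y $ i \<in> block J i"
    using assms by (auto simp: less_eq_vec_def K_plus_iff block_def)
  then show ?thesis using norm[of i] by (simp add: norms_def monotonic_norm_on_def)
qed

lemma norms_block_scale:
  assumes "x \<in> K_plus J" "\<And>i. 0 \<le> \<alpha> $ i"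
  shows "norms (block_scale \<alpha> x) = \<alpha> * norms x"
  using assms norm
  by (simp add: vec_eq_iff norms_def block_scale_def K_plus_def monotonic_norm_on_def norm_on_def)

lemma S_plus_iff: "x \<in> S_plus J \<nu> \<longleftrightarrow> x \<in> K_plus J \<and> norms x = 1"
  by (simp add: S_plus_def norms_def vec_eq_iff)

lemma S_plus_subset_K_plus_0: "S_plus J \<nu> \<subseteq> K_plus_0 J"
proof
  fix x assume x: "x \<in> S_plus J \<nu>"
  have "x $ i \<noteq> 0" for i
    using x norm[of i]
    by (auto simp: S_plus_def K_plus_def monotonic_norm_on_def norm_on_def) (metis zero_neq_one)
  then show "x \<in> K_plus_0 J" using x by (auto simp: S_plus_def K_plus_0_def)
qed

lemma normalise:
  assumes "x \<in> K_plus_0 J"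
  obtains \<alpha> where "\<And>i. 0 < \<alpha> $ i" "block_scale \<alpha> x \<in> S_plus J \<nu>"
proof
  let ?\<alpha> = "\<chi> i. inverse (norms x $ i)"
  have x: "x \<in> K_plus J" using assms by (simp add: K_plus_0_def)
  show a: "0 < ?\<alpha> $ i" for i using norms_pos[OF assms] by simp
  have "norms x $ i \<noteq> 0" for i using norms_pos[OF assms, of i] by simp
  then show "block_scale ?\<alpha> x \<in> S_plus J \<nu>"
    using x a
    by (auto simp: S_plus_iff norms_block_scale less_imp_le vec_eq_iff intro!: block_scale_in_K_plus)
qed

lemma spec_rad_eq:
  "spec_rad J \<nu> b F =
    (SUP x\<in>K_plus_0 J. limsup (\<lambda>m. ereal (wprod b (norms ((F ^^ m) x)) powr (1 / real m))))"
  by (simp add: spec_rad_def wprod_def norms_def)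

text \<open>
  A multiple of \<open>u\<close> dominates the starting point \<open>x\<close> and still has growth factor of weighted
  product \<open>wprod b \<theta>\<close>; the constant from the norm of that multiple disappears under the \<open>m\<close>-th root.
\<close>

lemma spec_rad_le:
  assumes "u \<in> K_pp J" "\<And>i. 0 < \<theta> $ i" "F u \<le> block_scale \<theta> u"
  shows "spec_rad J \<nu> b F \<le> ereal (wprod b \<theta>)"
  unfolding spec_rad_eq
proof (rule SUP_least)
  fix x assume x0: "x \<in> K_plus_0 J"
  then have x: "x \<in> K_plus J" by (simp add: K_plus_0_def)
  obtain c where c: "0 < c" "x \<le> block_scale (vec c) u"
    using K_pp_dominates[OF assms(1) x] .
  define v where "v = block_scale (vec c) u"
  define \<mu> where "\<mu> = rescaled_factor (vec c) \<theta>"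
  have u: "u \<in> K_plus J" using assms(1) K_pp_subset_K_plus by blast
  have v: "v \<in> K_plus J"
    unfolding v_def using c u by (intro block_scale_in_K_plus) auto
  have "F v \<le> block_scale \<mu> v"
    unfolding v_def \<mu>_def using assms c u by (intro F_block_scale_upper) auto
  moreover have "0 < \<mu> $ i" for i
    using assms(2) c(1) vec_powr_pos[of "vec c" A i] by (simp add: \<mu>_def rescaled_factor_def)
  moreover have w: "wprod b \<mu> = wprod b \<theta>"
    unfolding \<mu>_def using assms(2) c(1) by (intro wprod_rescaled_factor) (auto intro: less_imp_le)
  ultimately have it: "\<exists>\<beta>. (\<forall>i. 0 < \<beta> $ i) \<and> wprod b \<beta> = wprod b \<theta> ^ m \<and>
      (F ^^ m) v \<le> block_scale \<beta> v" for m
    using iterate_upper[OF v] by metis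
  define C where "C = wprod b (norms v)"
  have \<theta>0: "0 < wprod b \<theta>" using assms(2) by (rule wprod_pos)
  have "0 < norms v $ i" for i
    using norms_pos[OF x0, of i] norms_mono[OF x v, of i] c(2) by (simp add: v_def)
  then have C0: "0 < C" unfolding C_def by (rule wprod_pos)
  have bound: "wprod b (norms ((F ^^ m) x)) \<le> wprod b \<theta> ^ m * C" for m
  proof -
    obtain \<beta> where \<beta>: "\<And>i. 0 < \<beta> $ i" "wprod b \<beta> = wprod b \<theta> ^ m" "(F ^^ m) v \<le> block_scale \<beta> v"
      using it[of m] by blast
    have "(F ^^ m) x \<le> block_scale \<beta> v"
      using mono_iterate[OF x v, of m] \<beta>(3) c(2) by (auto simp: v_def)
    moreover have "block_scale \<beta> v \<in> K_plus J"
      using v \<beta> by (intro block_scale_in_K_plus) (auto intro: less_imp_le)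
    ultimately have "wprod b (norms ((F ^^ m) x)) \<le> wprod b (norms (block_scale \<beta> v))"
      using b_pos x
      by (intro wprod_mono norms_mono norms_nonneg maps_iterate) (auto intro: less_imp_le)
    also have "\<dots> = wprod b \<theta> ^ m * C"
      using \<beta> v by (simp add: norms_block_scale less_imp_le wprod_mult norms_nonneg C_def)
    finally show ?thesis .
  qed
  have "limsup (\<lambda>m. ereal (wprod b (norms ((F ^^ m) x)) powr (1 / real m)))
      \<le> limsup (\<lambda>m. ereal (wprod b \<theta> * C powr (1 / real m)))"
  proof (intro Limsup_mono eventually_sequentiallyI[of 1])
    fix m :: nat assume m: "1 \<le> m"
    have "wprod b (norms ((F ^^ m) x)) powr (1 / real m) \<le> (wprod b \<theta> ^ m * C) powr (1 / real m)"
      using bound by (intro powr_mono2) (auto simp: wprod_nonneg)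
    also have "\<dots> = wprod b \<theta> * C powr (1 / real m)"
      using m \<theta>0 C0 by (simp add: powr_mult powr_realpow[symmetric] powr_powr)
    finally show "ereal (wprod b (norms ((F ^^ m) x)) powr (1 / real m))
        \<le> ereal (wprod b \<theta> * C powr (1 / real m))" by simp
  qed
  also have "\<dots> = ereal (wprod b \<theta>)"
  proof -
    have "(\<lambda>m. ereal (wprod b \<theta> * C powr (1 / real m))) \<longlonglongrightarrow> ereal (wprod b \<theta> * C powr 0)"
      using C0 by (intro tendsto_intros lim_1_over_n) auto
    then show ?thesis
      using C0 by (intro lim_imp_Limsup) auto
  qed
  finally show "limsup (\<lambda>m. ereal (wprod b (norms ((F ^^ m) x)) powr (1 / real m)))
      \<le> ereal (wprod b \<theta>)" .
qed

lemma spec_rad_le_cw_upper: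
  assumes "u \<in> K_pp J"
  shows "spec_rad J \<nu> b F \<le> ereal (cw_upper J b F u)"
  using F_le_cw_upper[OF assms] spec_rad_le[OF assms] by metis

lemma cw_lower_le_spec_rad:
  assumes "x \<in> S_plus J \<nu>"
  shows "ereal (cw_lower J b F x) \<le> spec_rad J \<nu> b F"
proof -
  have x: "x \<in> K_plus_0 J" "x \<in> K_plus J" "norms x = 1"
    using assms S_plus_subset_K_plus_0 by (auto simp: S_plus_iff)
  obtain \<theta> where \<theta>: "\<And>i. 0 \<le> \<theta> $ i" "block_scale \<theta> x \<le> F x" "wprod b \<theta> = cw_lower J b F x"
    using cw_lower_le_F[OF x(1)] by blast
  have "wprod b \<theta> \<le> wprod b (norms ((F ^^ m) x)) powr (1 / real m)" if m: "1 \<le> m" for m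
  proof (cases "\<forall>i. 0 < \<theta> $ i")
    case True
    then obtain \<beta> where \<beta>: "\<And>i. 0 < \<beta> $ i" "wprod b \<beta> = wprod b \<theta> ^ m"
        "block_scale \<beta> x \<le> (F ^^ m) x"
      using iterate_lower[OF x(2) _ \<theta>(2), of m] by blast
    have "\<beta> $ i \<le> norms ((F ^^ m) x) $ i" for i
    proof -
      have "norms (block_scale \<beta> x) $ i \<le> norms ((F ^^ m) x) $ i"
        using \<beta> x by (intro norms_mono block_scale_in_K_plus maps_iterate) (auto intro: less_imp_le)
      then show ?thesis using \<beta> x by (simp add: norms_block_scale less_imp_le)
    qed
    then have "wprod b \<beta> \<le> wprod b (norms ((F ^^ m) x))"
      using \<beta>(1) b_pos by (intro wprod_mono) (auto intro: less_imp_le)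
    then have "(wprod b \<theta> ^ m) powr (1 / real m) \<le> wprod b (norms ((F ^^ m) x)) powr (1 / real m)"
      using wprod_nonneg[of b \<theta>] by (intro powr_mono2) (auto simp: \<beta>(2))
    moreover have "(wprod b \<theta> ^ m) powr (1 / real m) = wprod b \<theta>"
      using m wprod_pos[of \<theta> b] True by (simp add: powr_realpow[symmetric] powr_powr)
    ultimately show ?thesis by simp
  next
    \<comment> \<open>A vanishing factor makes the whole lower number vanish.\<close>
    case False
    then obtain i where "\<theta> $ i = 0" using \<theta>(1) by (metis order_le_less)
    then have "wprod b \<theta> = 0" by (auto simp: wprod_def)
    then show ?thesis by simp
  qed
  then have "ereal (wprod b \<theta>) \<le> limsup (\<lambda>m. ereal (wprod b (norms ((F ^^ m) x)) powr (1 / real m)))"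
    by (intro le_Limsup eventually_sequentiallyI[of 1]) auto
  also have "\<dots> \<le> spec_rad J \<nu> b F"
    unfolding spec_rad_eq using x(1) by (rule SUP_upper)
  finally show ?thesis by (simp add: \<theta>(3))
qed

section \<open>A maximiser of the lower Collatz--Wielandt numbers\<close>

text \<open>
  The infimum runs over the unit spheres only, but the weighted product of a growth factor does
  not see the rescaling that brings \<open>u\<close> there.
\<close>

lemma INF_cw_upper_le:
  assumes "u \<in> K_pp J" "\<And>i. 0 \<le> \<theta> $ i" "F u \<le> block_scale \<theta> u"
  shows "(INF x\<in>S_pp J \<nu>. ereal (cw_upper J b F x)) \<le> ereal (wprod b \<theta>)"
proof -
  have u: "u \<in> K_plus J" using assms(1) K_pp_subset_K_plus by blast
  have "u $ i \<noteq> 0" for i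
    using assms(1) J_nonempty[of i] by (force simp: K_pp_def)
  then have "u \<in> K_plus_0 J" using u by (simp add: K_plus_0_def)
  then obtain \<alpha> where \<alpha>: "\<And>i. 0 < \<alpha> $ i" "block_scale \<alpha> u \<in> S_plus J \<nu>"
    using normalise by blast
  have pp: "block_scale \<alpha> u \<in> K_pp J"
    using assms(1) \<alpha>(1) by (rule block_scale_in_K_pp)
  have "(INF x\<in>S_pp J \<nu>. ereal (cw_upper J b F x)) \<le> ereal (cw_upper J b F (block_scale \<alpha> u))"
    using pp \<alpha>(2) by (intro INF_lower) (simp add: S_pp_def)
  also have "\<dots> \<le> ereal (wprod b (rescaled_factor \<alpha> \<theta>))"
    using cw_upper_le[OF pp F_block_scale_upper[OF u \<alpha>(1) assms(3)]] by simp
  also have "\<dots> = ereal (wprod b \<theta>)"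
    using wprod_rescaled_factor[OF \<alpha>(1) assms(2)] by simp
  finally show ?thesis .
qed

text \<open>
  The eigenvectors of the perturbed maps stay in a compact set, and their factors are block sums,
  which depend continuously on the vector. In the limit \<open>x\<close> may have zero coordinates and
  \<open>\<theta>\<close> zero entries; the bound on \<open>wprod b \<theta>\<close> nevertheless passes to the limit, since all
  perturbed eigenvectors are positive and \<open>wprod b\<close> is continuous up to the boundary.
\<close>

lemma exists_eigenvector:
  "\<exists>x \<theta>. x \<in> K_plus_0 J \<and> (\<forall>i. 0 \<le> \<theta> $ i) \<and> F x = block_scale \<theta> x \<and>
    (INF x\<in>S_pp J \<nu>. ereal (cw_upper J b F x)) \<le> ereal (wprod b \<theta>)"
proof -
  define \<delta> where "\<delta> n = inverse (real (Suc n))" for n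
  define P where "P n x = F x + \<delta> n *\<^sub>R ones J" for n x
  define L where "L y = (\<chi> i. \<Sum>j\<in>UNIV. y $ i $ j)" for y :: "real ^ 'n ^ 'd"
  have \<delta>0: "0 < \<delta> n" for n by (simp add: \<delta>_def)
  have "\<exists>x\<in>simplices. P n x = block_scale (L (P n x)) x" for n
    using perturbed_eigenvector[OF \<delta>0[of n]] unfolding P_def L_def by metis
  then obtain X where X: "\<And>n. X n \<in> simplices" "\<And>n. P n (X n) = block_scale (L (P n (X n))) (X n)"
    by metis
  have XK: "X n \<in> K_plus J" for n using X(1)[of n] by (simp add: simplices_def)
  have L0: "0 \<le> L y $ i" if "y \<in> K_plus J" for y i
    using that by (simp add: L_def K_plus_iff sum_nonneg)
  have Ppp: "P n (X n) \<in> K_pp J" for n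
    using maps[OF XK[of n]] \<delta>0[of n]
    by (auto simp: K_plus_iff K_pp_def P_def ones_def block_def intro!: add_nonneg_pos)
  then have PK: "P n (X n) \<in> K_plus J" for n using K_pp_subset_K_plus by blast
  have lower: "(INF x\<in>S_pp J \<nu>. ereal (cw_upper J b F x)) \<le> ereal (wprod b (L (P n (X n))))" for n
  proof (rule INF_cw_upper_le)
    show "X n \<in> K_pp J"
    proof -
      have "0 < X n $ i $ j" if "j \<in> J i" for i j
      proof -
        have "0 < P n (X n) $ i $ j" using Ppp[of n] that by (auto simp: K_pp_def)
        then have "0 < L (P n (X n)) $ i * X n $ i $ j" by (subst (asm) X(2)) simp
        then show ?thesis using L0[OF PK[of n], of i] by (simp add: zero_less_mult_iff)
      qed
      then show ?thesis using XK[of n] by (auto simp: K_plus_def K_pp_def)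
    qed
    show "0 \<le> L (P n (X n)) $ i" for i by (rule L0[OF PK])
    have "F (X n) \<le> P n (X n)"
      using \<delta>0[of n] by (simp add: P_def less_eq_vec_def ones_def)
    then show "F (X n) \<le> block_scale (L (P n (X n))) (X n)" using X(2)[of n] by simp
  qed
  obtain x r where x: "x \<in> simplices" "strict_mono r" "(X \<circ> r) \<longlonglongrightarrow> x"
    using compact_simplices X(1) unfolding compact_def by metis
  have xK: "x \<in> K_plus J" using x(1) by (simp add: simplices_def)
  have limX: "(\<lambda>n. X (r n)) \<longlonglongrightarrow> x" using x(3) by (simp add: o_def)
  have limF: "(\<lambda>n. F (X (r n))) \<longlonglongrightarrow> F x"
    using continuous_on_tendsto_compose[OF cont limX xK] XK by simp
  have lim\<delta>: "(\<lambda>n. \<delta> (r n)) \<longlonglongrightarrow> 0"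
    using LIMSEQ_subseq_LIMSEQ[OF LIMSEQ_inverse_real_of_nat x(2)] by (simp add: \<delta>_def o_def)
  have "(\<lambda>n. P (r n) (X (r n))) \<longlonglongrightarrow> F x + 0 *\<^sub>R ones J"
    unfolding P_def by (intro tendsto_intros limF lim\<delta>)
  then have limP: "(\<lambda>n. P (r n) (X (r n))) \<longlonglongrightarrow> F x" by simp
  have limL: "(\<lambda>n. L (P (r n) (X (r n)))) \<longlonglongrightarrow> L (F x)"
    unfolding L_def by (intro tendsto_intros limP)
  have "(\<lambda>n. block_scale (L (P (r n) (X (r n)))) (X (r n))) \<longlonglongrightarrow> block_scale (L (F x)) x"
    unfolding block_scale_def by (intro tendsto_intros limL limX)
  then have eig: "F x = block_scale (L (F x)) x"
    using X(2) limP by (metis (no_types, lifting) LIMSEQ_unique ext)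
  have "(\<lambda>n. wprod b (L (P (r n) (X (r n))))) \<longlonglongrightarrow> wprod b (L (F x))"
    unfolding wprod_def
  proof (intro tendsto_prod)
    fix i
    \<comment> \<open>Some factors may tend to zero, where only a positive exponent keeps \<open>powr\<close> continuous.\<close>
    show "(\<lambda>n. L (P (r n) (X (r n))) $ i powr b $ i) \<longlonglongrightarrow> L (F x) $ i powr b $ i"
      using b_pos L0[OF PK]
      by (intro tendsto_powr' tendsto_vec_nth limL tendsto_const) (auto intro!: always_eventually)
  qed
  then have "(\<lambda>n. ereal (wprod b (L (P (r n) (X (r n)))))) \<longlonglongrightarrow> ereal (wprod b (L (F x)))"
    by (rule tendsto_ereal)
  then have "(INF x\<in>S_pp J \<nu>. ereal (cw_upper J b F x)) \<le> ereal (wprod b (L (F x)))"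
    by (rule LIMSEQ_le_const) (use lower in blast)
  then show ?thesis
    using x(1) simplices_subset_K_plus_0 L0[OF maps[OF xK]] eig by blast
qed

lemma exists_cw_lower_ge_INF:
  "\<exists>x\<in>S_plus J \<nu>. (INF x\<in>S_pp J \<nu>. ereal (cw_upper J b F x)) \<le> ereal (cw_lower J b F x)"
proof -
  obtain x \<theta> where x: "x \<in> K_plus_0 J" "\<And>i. 0 \<le> \<theta> $ i" "F x = block_scale \<theta> x"
    "(INF x\<in>S_pp J \<nu>. ereal (cw_upper J b F x)) \<le> ereal (wprod b \<theta>)"
    using exists_eigenvector by blast
  obtain \<alpha> where \<alpha>: "\<And>i. 0 < \<alpha> $ i" "block_scale \<alpha> x \<in> S_plus J \<nu>"
    using normalise[OF x(1)] by blast
  have "x \<in> K_plus J" using x(1) by (simp add: K_plus_0_def)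
  then have "cw_lower J b F (block_scale \<alpha> x) = wprod b (rescaled_factor \<alpha> \<theta>)"
    using \<alpha> x S_plus_subset_K_plus_0 by (intro cw_lower_eigen F_block_scale_eigen) auto
  also have "\<dots> = wprod b \<theta>" using \<alpha>(1) x(2) by (rule wprod_rescaled_factor)
  finally show ?thesis using \<alpha>(2) x(4) by (intro bexI[of _ "block_scale \<alpha> x"]) simp
qed

end

theorem theorem4p1:
  fixes J :: "'d::finite \<Rightarrow> 'n::finite set"
    and \<nu> :: "'d \<Rightarrow> real ^ 'n \<Rightarrow> real"
    and F :: "real ^ 'n ^ 'd \<Rightarrow> real ^ 'n ^ 'd"
    and A :: "real ^ 'd ^ 'd"
    and b :: "real ^ 'd"
  assumes "\<And>i. J i \<noteq> {}"
    and "\<And>i. monotonic_norm_on (block J i) (\<nu> i)"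
    and "F \<in> class_H J"
    and "multi_homogeneous J F A"
    and "b \<in> simplex_pp"
    and "transpose A *v b = b"
  shows "(INF x\<in>S_pp J \<nu>. ereal (cw_upper J b F x)) = spec_rad J \<nu> b F \<and>
    (\<exists>x\<in>S_plus J \<nu>. spec_rad J \<nu> b F = ereal (cw_lower J b F x) \<and>
       (\<forall>y\<in>S_plus J \<nu>. cw_lower J b F y \<le> cw_lower J b F x))"
proof -
  interpret normed_multi_homogeneous_map J F A b \<nu>
    using assms
    by unfold_locales
      (auto simp: class_H_def order_preserving_def multi_homogeneous_def simplex_pp_def)
  let ?U = "INF x\<in>S_pp J \<nu>. ereal (cw_upper J b F x)"
  have RU: "spec_rad J \<nu> b F \<le> ?U"
    by (rule INF_greatest) (simp add: S_pp_def spec_rad_le_cw_upper)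
  obtain x where x: "x \<in> S_plus J \<nu>" "?U \<le> ereal (cw_lower J b F x)"
    using exists_cw_lower_ge_INF by blast
  have xR: "ereal (cw_lower J b F x) \<le> spec_rad J \<nu> b F"
    using x(1) by (rule cw_lower_le_spec_rad)
  have eq: "?U = spec_rad J \<nu> b F" "spec_rad J \<nu> b F = ereal (cw_lower J b F x)"
    using RU x(2) xR by (auto intro: antisym order_trans)
  moreover have "cw_lower J b F y \<le> cw_lower J b F x" if "y \<in> S_plus J \<nu>" for y
    using cw_lower_le_spec_rad[OF that] eq(2) by simp
  ultimately show ?thesis using x(1) by blast
qed

end
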